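(* Let $R$ be a commutative ring and let $A=\begin{bmatrix} a & b\\ b & c\end{bmatrix}\in Um(\mathbb{M}_2(R))$ be symmetric and with zero determinant. Then the following properties hold: (1) The matrix $A$ is simply extendable if there exists $(e,f)\in R^2$ such that $ae^2-cf^2\in U(R)$, and the converse holds if $R$ has characteristic $2$. (2) Assume that $R$ is a reduced Hermite ring of characteristic $2$. If $b$ is not a zero divisor, then $A$ is simply extendable.
   Context: Rings are commutative with identity; $U(R)$ is the group of units. $Um(\mathbb{M}_2(R))$ is the set of $2\times2$ matrices whose entries generate the unit ideal of $R$. $A\in\mathbb{M}_2(R)$ is simply extendable if there is $A^+\in SL_3(R)$ whose upper-left $2\times2$ block is $A$ and whose $(3,3)$ entry is $0$. $R$ is a Hermite ring (in the sense of Kaplansky) if for every $(p,q)\in R^2$ there are $r,s,t\in R$ with $p=rs$, $q=rt$ and $Rs+Rt=R$. *)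

theory Defs
  imports "HOL-Analysis.Analysis"
begin

abbreviation ideal_gen :: "'a::comm_ring_1 set \<Rightarrow> 'a set"
  where "ideal_gen \<equiv> module.span (*)"

lemma module_mult: "module ((*) :: 'a::comm_ring_1 \<Rightarrow> 'a \<Rightarrow> 'a)"
  by unfold_locales (simp_all add: algebra_simps)

definition unimodular_mat :: "'a::comm_ring_1^2^2 \<Rightarrow> bool"
  where "unimodular_mat A \<longleftrightarrow> ideal_gen {A $ i $ j | i j. True} = UNIV"

text \<open>In the index type \<^typ>\<open>3\<close>, the indices 1, 2, 3 are the first, second and third row or column
  (as in the library lemma \<open>det_3\<close>).\<close>

definition simply_extendable :: "'a::comm_ring_1^2^2 \<Rightarrow> bool"
  where "simply_extendable A \<longleftrightarrow>
    (\<exists>B :: 'a^3^3. det B = 1 \<and>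
       B $ 1 $ 1 = A $ 1 $ 1 \<and> B $ 1 $ 2 = A $ 1 $ 2 \<and>
       B $ 2 $ 1 = A $ 2 $ 1 \<and> B $ 2 $ 2 = A $ 2 $ 2 \<and>
       B $ 3 $ 3 = 0)"

text \<open>The ring in the next two definitions is a whole type, passed as \<^term>\<open>TYPE('a::comm_ring_1)\<close>.\<close>

definition hermite_ring :: "'a::comm_ring_1 itself \<Rightarrow> bool"
  where "hermite_ring _ \<longleftrightarrow>
    (\<forall>p q :: 'a. \<exists>r s t. p = r * s \<and> q = r * t \<and> ideal_gen {s, t} = UNIV)"

definition reduced_ring :: "'a::comm_ring_1 itself \<Rightarrow> bool"
  where "reduced_ring _ \<longleftrightarrow> (\<forall>(x :: 'a) n. x ^ n = 0 \<longrightarrow> x = 0)"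

definition zero_divisor :: "'a::comm_ring_1 \<Rightarrow> bool"
  where "zero_divisor x \<longleftrightarrow> (\<exists>y. y \<noteq> 0 \<and> x * y = 0)"

end

(*
  Expanding along the last row and column, A is simply extendable iff
  u (b y - c x) - v (a y - b x) = 1 for some u, v, x, y. Squaring this identity in characteristic 2
  and using b^2 = a c turns it into (a v^2 + c u^2) (a y^2 + c x^2) = 1, so a y^2 + c x^2 is a unit.
  For the Hermite case write a = d s and b = d t with (s, t) = (1). Then s c = d t^2, so s divides d,
  say d = s w, and A is w times the symmetric square of the row (s, t). Unimodularity makes w a
  unit, and squaring p s + q t = 1 in characteristic 2 gives a p^2 + c q^2 = w.
*)
theory Submission
  imports Defs
begin

lemma ideal_gen_pair_UNIV:
  fixes s t :: "'a::comm_ring_1"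
  assumes "ideal_gen {s, t} = UNIV"
  shows "\<exists>p q. p * s + q * t = 1"
proof -
  interpret module "(*) :: 'a \<Rightarrow> 'a \<Rightarrow> 'a" by (rule module_mult)
  have "1 \<in> ideal_gen {s, t}" using assms by simp
  then obtain p q where "1 - p * s - q * t = 0"
    by (auto simp: span_breakdown_eq span_empty)
  then have "p * s + q * t = 1" by (simp add: algebra_simps)
  then show ?thesis by blast
qed

text \<open>The multiples of \<open>w\<close> form an ideal that contains every entry, hence also 1.
  This is how unimodularity is used in the Hermite case.\<close>

lemma common_divisor_unimodular_mat_dvd_1:
  fixes A :: "'a::comm_ring_1^2^2"
  assumes "unimodular_mat A" "\<And>i j. w dvd A $ i $ j"
  shows "w dvd 1"
proof -
  interpret module "(*) :: 'a \<Rightarrow> 'a \<Rightarrow> 'a" by (rule module_mult)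
  have "1 \<in> ideal_gen {A $ i $ j | i j. True}"
    using assms(1) by (simp add: unimodular_mat_def)
  then show ?thesis
    by (induction rule: span_induct_alt) (auto intro!: dvd_add dvd_mult assms(2))
qed

text \<open>The zero corner removes the \<open>det A\<close> term from the 3x3 determinant, leaving
  an expression bilinear in the new column \<open>(u, v)\<close> and the new row
  \<open>(x, y)\<close>.\<close>

lemma simply_extendable_iff:
  fixes A :: "'a::comm_ring_1^2^2"
  shows "simply_extendable A \<longleftrightarrow> (\<exists>u v x y.
    u * (A$2$1 * y - A$2$2 * x) - v * (A$1$1 * y - A$1$2 * x) = 1)"
proof
  assume "simply_extendable A"
  then obtain B :: "'a^3^3" where "det B = 1"
    "B$1$1 = A$1$1" "B$1$2 = A$1$2" "B$2$1 = A$2$1" "B$2$2 = A$2$2" "B$3$3 = 0"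
    by (auto simp: simply_extendable_def)
  then have "B$1$3 * (A$2$1 * B$3$2 - A$2$2 * B$3$1)
      - B$2$3 * (A$1$1 * B$3$2 - A$1$2 * B$3$1) = 1"
    by (simp add: det_3 algebra_simps)
  then show "\<exists>u v x y. u * (A$2$1 * y - A$2$2 * x) - v * (A$1$1 * y - A$1$2 * x) = 1"
    by blast
next
  assume "\<exists>u v x y. u * (A$2$1 * y - A$2$2 * x) - v * (A$1$1 * y - A$1$2 * x) = 1"
  then obtain u v x y where
    *: "u * (A$2$1 * y - A$2$2 * x) - v * (A$1$1 * y - A$1$2 * x) = 1" by blast
  define B :: "'a^3^3" where
    "B = vector [vector [A$1$1, A$1$2, u], vector [A$2$1, A$2$2, v], vector [x, y, 0]]"
  have "det B = 1"
    using * by (simp add: B_def det_3 algebra_simps)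
  then show "simply_extendable A"
    unfolding simply_extendable_def by (intro exI[of _ B]) (simp add: B_def)
qed

lemma CHAR_2_minus_eq_plus:
  fixes x y :: "'a::comm_ring_1"
  assumes "CHAR('a) = 2"
  shows "x - y = x + y"
proof -
  have "(2::'a) = 0" using of_nat_CHAR[where 'a = 'a] assms by simp
  then have "y + y = 0" by (metis mult_2 mult_zero_left)
  then have "- y = y" by (rule minus_unique)
  then show ?thesis by (simp add: diff_conv_add_uminus del: add_uminus_conv_diff)
qed

lemma CHAR_2_square_add:
  fixes x y :: "'a::comm_ring_1"
  assumes "CHAR('a) = 2"
  shows "(x + y)\<^sup>2 = x\<^sup>2 + y\<^sup>2"
proof -
  have "(2::'a) = 0" using of_nat_CHAR[where 'a = 'a] assms by simp
  then show ?thesis by (simp add: power2_sum)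
qed

text \<open>With new row \<open>(f, e)\<close> and new column proportional to
  \<open>(f, -e)\<close>, symmetry cancels the two terms in \<open>b * e * f\<close>, so the
  determinant is a multiple of the diagonal form; the inverse \<open>k\<close> scales it to
  1.\<close>

lemma simply_extendable_if_diagonal_form_unit:
  fixes A :: "'a::comm_ring_1^2^2"
  assumes "A$2$1 = A$1$2" "A$1$1 * e\<^sup>2 - A$2$2 * f\<^sup>2 dvd 1"
  shows "simply_extendable A"
proof -
  obtain k where k: "1 = (A$1$1 * e\<^sup>2 - A$2$2 * f\<^sup>2) * k" using assms(2) by (elim dvdE)
  have "(f * k) * (A$2$1 * e - A$2$2 * f) - (- e * k) * (A$1$1 * e - A$1$2 * f) = 1"
    unfolding k assms(1) by (simp add: algebra_simps power2_eq_square)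
  then show ?thesis unfolding simply_extendable_iff by blast
qed

lemma CHAR_2_diagonal_form_unit:
  fixes A :: "'a::comm_ring_1^2^2"
  assumes "CHAR('a) = 2" "A$2$1 = A$1$2" "det A = 0" "simply_extendable A"
  shows "\<exists>e f. A$1$1 * e\<^sup>2 - A$2$2 * f\<^sup>2 dvd 1"
proof -
  note plus = CHAR_2_minus_eq_plus[OF assms(1)]
  note sq = CHAR_2_square_add[OF assms(1)]
  define a b c where "a = A$1$1" and "b = A$1$2" and "c = A$2$2"
  have b2: "b\<^sup>2 = a * c"
    using assms(2,3) by (simp add: det_2 a_def b_def c_def power2_eq_square)
  obtain u v x y where "u * (b * y - c * x) - v * (a * y - b * x) = 1"
    using assms(2,4) by (auto simp: simply_extendable_iff a_def b_def c_def)
  \<comment> \<open>After squaring, the cross terms vanish and \<open>b\<close> occurs only as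
    \<open>b\<^sup>2\<close>, which can be replaced by \<open>a * c\<close>.\<close>
  then have "1 = (u * (b * y + c * x) + v * (a * y + b * x))\<^sup>2" by (simp add: plus)
  also have "\<dots> = u\<^sup>2 * (b\<^sup>2 * y\<^sup>2 + c\<^sup>2 * x\<^sup>2) + v\<^sup>2 * (a\<^sup>2 * y\<^sup>2 + b\<^sup>2 * x\<^sup>2)"
    by (simp add: sq power_mult_distrib)
  \<comment> \<open>The \<open>u\<close> part is \<open>c * u\<^sup>2\<close> and the
    \<open>v\<close> part \<open>a * v\<^sup>2\<close> times the same form, so the new row gives the
    witnesses \<open>e = y\<close> and \<open>f = x\<close>.\<close>
  also have "\<dots> = (a * y\<^sup>2 - c * x\<^sup>2) * (a * v\<^sup>2 + c * u\<^sup>2)"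
    unfolding b2 plus by (simp add: algebra_simps power2_eq_square)
  finally show ?thesis unfolding a_def c_def by (metis dvdI)
qed

text \<open>The conclusion is the unit criterion itself, so extendability then follows as in the
  first part.\<close>

lemma hermite_CHAR_2_diagonal_form_unit:
  fixes A :: "'a::comm_ring_1^2^2"
  assumes "CHAR('a) = 2" "hermite_ring TYPE('a)" "unimodular_mat A" "A$2$1 = A$1$2" "det A = 0"
    and nzd: "\<not> zero_divisor (A$1$2)"
  shows "\<exists>e f. A$1$1 * e\<^sup>2 - A$2$2 * f\<^sup>2 dvd 1"
proof -
  note plus = CHAR_2_minus_eq_plus[OF assms(1)]
  note sq = CHAR_2_square_add[OF assms(1)]
  define a b c where "a = A$1$1" and "b = A$1$2" and "c = A$2$2"
  have b2: "a * c = b * b"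
    using assms(4,5) by (simp add: det_2 a_def b_def c_def)
  \<comment> \<open>A divisor of a non-zero-divisor is again a non-zero-divisor; this will be
    applied to \<open>d\<close> and then to \<open>s\<close>.\<close>
  have cancel: "m = n" if k: "k dvd b" and eq: "k * m = k * n" for k m n
  proof -
    obtain l where "b = k * l" using k by (elim dvdE)
    then have "b * (m - n) = l * (k * m - k * n)" by (simp add: algebra_simps)
    then have "b * (m - n) = 0" using eq by simp
    then have "m - n = 0" using nzd unfolding zero_divisor_def b_def by blast
    then show ?thesis by simp
  qed
  obtain d s t where d: "a = d * s" "b = d * t" "ideal_gen {s, t} = UNIV"
    using assms(2) unfolding hermite_ring_def by blast
  obtain p q where "p * s + q * t = 1" using ideal_gen_pair_UNIV[OF d(3)] by blast
  then have pq: "p\<^sup>2 * s\<^sup>2 + q\<^sup>2 * t\<^sup>2 = 1"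
    by (metis sq power_mult_distrib power_one)
  \<comment> \<open>Cancels \<open>d\<close> from \<open>a * c = b * b\<close> written as
    \<open>d * (s * c) = d * (d * t\<^sup>2)\<close>.\<close>
  have sc: "s * c = d * t\<^sup>2"
    by (rule cancel[of d]) (use b2 d in \<open>simp_all add: power2_eq_square mult_ac\<close>)
  \<comment> \<open>This is the value \<open>a * p\<^sup>2 + c * q\<^sup>2\<close> of the form;
    multiplying it by \<open>s\<close> and using \<open>sc\<close> turns it into \<open>d\<close>
    times the squared Bezout identity.\<close>
  define w where "w = d * s * p\<^sup>2 + c * q\<^sup>2"
  have "d = d * (p\<^sup>2 * s\<^sup>2 + q\<^sup>2 * t\<^sup>2)" by (simp add: pq)
  also have "\<dots> = s * (d * s * p\<^sup>2) + (d * t\<^sup>2) * q\<^sup>2"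
    by (simp add: algebra_simps power2_eq_square)
  also have "\<dots> = s * w" unfolding sc[symmetric] w_def by (simp add: algebra_simps)
  finally have dw: "d = s * w" .
  \<comment> \<open>Since \<open>b = s * w * t\<close>, the factor \<open>s\<close> may be cancelled
    too. Now \<open>a\<close>, \<open>b\<close>, \<open>c\<close> are \<open>w\<close> times
    \<open>s\<^sup>2\<close>, \<open>s * t\<close>, \<open>t\<^sup>2\<close>.\<close>
  have c: "c = w * t\<^sup>2"
    by (rule cancel[of s]) (use sc d(2) dw in \<open>simp_all add: mult.assoc\<close>)
  have "w dvd A$i$j" for i j
  proof -
    have "w dvd a" "w dvd b" "w dvd c" by (simp_all add: c d(1,2) dw)
    then show ?thesis
      using exhaust_2[of i] exhaust_2[of j] assms(4) by (auto simp: a_def b_def c_def)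
  qed
  then have "w dvd 1" by (rule common_divisor_unimodular_mat_dvd_1[OF assms(3)])
  moreover have "a * p\<^sup>2 - c * q\<^sup>2 = w"
    unfolding plus by (simp add: w_def d(1))
  ultimately show ?thesis unfolding a_def c_def by metis
qed

theorem mainTheorem9:
  fixes a b c :: "'a::comm_ring_1" and A :: "'a^2^2"
  assumes "A = vector [vector [a, b], vector [b, c]]"
    and "unimodular_mat A"
    and "det A = 0"
  shows "((\<exists>e f. a * e\<^sup>2 - c * f\<^sup>2 dvd 1) \<longrightarrow> simply_extendable A) \<and>
    (CHAR('a) = 2 \<longrightarrow> simply_extendable A \<longrightarrow> (\<exists>e f. a * e\<^sup>2 - c * f\<^sup>2 dvd 1)) \<and>
    (reduced_ring TYPE('a) \<longrightarrow> hermite_ring TYPE('a) \<longrightarrow> CHAR('a) = 2 \<longrightarrow>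
      \<not> zero_divisor b \<longrightarrow> simply_extendable A)"
proof -
  have entries: "A$1$1 = a" "A$1$2 = b" "A$2$1 = b" "A$2$2 = c"
    by (simp_all add: assms(1))
  then have sym: "A$2$1 = A$1$2" by simp
  show ?thesis
    using simply_extendable_if_diagonal_form_unit[OF sym]
      CHAR_2_diagonal_form_unit[OF _ sym assms(3)]
      hermite_CHAR_2_diagonal_form_unit[OF _ _ assms(2) sym assms(3)]
    unfolding entries by blast
qed

end
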